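(* Consider a row of $n\ge 1$ seats with a single entrance at one end, filled by selfish theatregoers who choose seats uniformly at random among the accessible empty seats (model described in the context). The expected number of occupied seats when the process ends equals $H_n=\sum_{k=1}^n \frac1k$, the $n$th harmonic number.
   Context: Row model: a row consists of $n$ seats numbered $1,\dots,n$ from left to right, with a single entrance at the left end (next to seat 1). Theatregoers arrive one at a time. A selfish theatregoer, once seated, never gets up, so no later theatregoer can walk past her seat. An empty seat is accessible if it can be reached from the entrance without passing a seat occupied by a selfish theatregoer. Each arriving theatregoer sits in an accessible empty seat chosen uniformly at random among all accessible empty seats; the process ends when no accessible empty seat remains. Here all theatregoers are selfish. *)

theory Defs
  imports "HOL-Probability.Probability"
begin

text \<open>
  Seats are \<open>1, \<dots>, n\<close>, with the entrance next to seat \<open>1\<close>. The set \<open>S\<close> is the set of occupied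
  seats. All occupants are selfish, so each of them blocks every seat to her right.
\<close>

definition accessible_seats :: "nat \<Rightarrow> nat set \<Rightarrow> nat set" where
  "accessible_seats n S = {s \<in> {1..n}. s \<notin> S \<and> (\<forall>t\<in>S. \<not> t < s)}"

lemma accessible_seats_subset: "accessible_seats n S \<subseteq> {1..n} - S"
  by (auto simp: accessible_seats_def)

lemma finite_accessible_seats [simp, intro]: "finite (accessible_seats n S)"
  by (rule finite_subset[OF accessible_seats_subset]) simp

text \<open>The law of the final set of occupied seats when the process is started from \<open>S\<close>.\<close>

function fill_row :: "nat \<Rightarrow> nat set \<Rightarrow> nat set pmf" where
  "fill_row n S =
     (if accessible_seats n S = {} then return_pmf S
      else bind_pmf (pmf_of_set (accessible_seats n S)) (\<lambda>s. fill_row n (insert s S)))"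
  by auto
termination
proof (relation "Wellfounded.measure (\<lambda>(n, S). card ({1..n} - S))", goal_cases)
  case 1
  show ?case by simp
next
  case (2 n S s)
  then have "s \<in> accessible_seats n S"
    by simp
  then have "s \<in> {1..n} - S"
    by (rule subsetD[OF accessible_seats_subset])
  then have "{1..n} - insert s S \<subset> {1..n} - S"
    by blast
  then have "card ({1..n} - insert s S) < card ({1..n} - S)"
    by (rule psubset_card_mono[rotated]) simp
  then show ?case
    by (simp only: in_measure prod.case)
qed

declare fill_row.simps [simp del]

end

theory Submission
  imports Defs
begin

text \<open>
  Once seat \<open>s\<close> is taken, exactly the seats \<open>1, \<dots>, s - 1\<close> remain accessible, so the state of the
  process is determined by the number \<open>m\<close> of accessible seats, and its next value is uniform on
  \<open>0, \<dots>, m - 1\<close>. The expected number of further occupants \<open>e m\<close> therefore satisfies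
  \<open>m * e m = (\<Sum>s=1..m. 1 + e (s - 1))\<close>, a recurrence solved by the harmonic numbers.
\<close>

lemma accessible_seats_insert:
  assumes "s \<in> accessible_seats n S"
  shows "accessible_seats n (insert s S) = accessible_seats n S \<inter> {..<s}"
  using assms by (auto simp: accessible_seats_def)

text \<open>Finite support is the side condition for averaging the expectation over the first choice
  of seat.\<close>

lemma finite_set_pmf_fill_row: "finite (set_pmf (fill_row n S))"
proof (induction n S rule: fill_row.induct)
  case (1 n S)
  show ?case
    using 1 by (subst fill_row.simps) auto
qed

text \<open>Going from \<open>m\<close> to \<open>m + 1\<close> adds \<open>1 + harm m\<close> to
  both sides, since \<open>(m + 1) * harm (m + 1) = (m + 1) * harm m + 1\<close>.\<close>

lemma sum_Suc_harm_pred: "(\<Sum>s=1..m. 1 + harm (s - 1)) = real m * harm m"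
  by (induction m) (simp_all add: harm_Suc field_simps)

text \<open>Generalised from the empty row to any \<open>S\<close> leaving an initial segment
  accessible, a form that every move preserves. Induction is strong because \<open>m\<close> may
  drop to any smaller value.\<close>

lemma expectation_card_fill_row:
  assumes "finite S" and "accessible_seats n S = {1..m}"
  shows "measure_pmf.expectation (fill_row n S) (\<lambda>T. real (card T)) = real (card S) + harm m"
  using assms
proof (induction m arbitrary: S rule: less_induct)
  case (less m)
  show ?case
  proof (cases "m = 0")
    case True
    then show ?thesis
      using less.prems by (subst fill_row.simps) (simp add: harm_def)
  next
    case False
    have step: "measure_pmf.expectation (fill_row n (insert s S)) (\<lambda>T. real (card T))
        = real (card S) + (1 + harm (s - 1))" if s: "s \<in> {1..m}" for s
    proof -
      have acc: "s \<in> accessible_seats n S"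
        using s less.prems by simp
      \<comment> \<open>The seat is new, so \<open>card\<close> grows by exactly one: this is the
        \<open>1\<close> in \<open>step\<close>.\<close>
      then have "s \<notin> S"
        by (simp add: accessible_seats_def)
      moreover have "accessible_seats n (insert s S) = {1..s - 1}"
        using s less.prems accessible_seats_insert[OF acc] by auto
      moreover have "s - 1 < m"
        using s by auto
      ultimately show ?thesis
        using less.IH[of "s - 1" "insert s S"] less.prems by simp
    qed
    have "measure_pmf.expectation (fill_row n S) (\<lambda>T. real (card T))
        = measure_pmf.expectation (pmf_of_set {1..m} \<bind> (\<lambda>s. fill_row n (insert s S)))
            (\<lambda>T. real (card T))"
      using False less.prems by (subst fill_row.simps) simp
    also have "\<dots> = (\<Sum>s\<in>{1..m}.
        measure_pmf.expectation (fill_row n (insert s S)) (\<lambda>T. real (card T)) / real m)"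
      using False
      by (subst pmf_expectation_bind_pmf_of_set)
        (auto simp: finite_set_pmf_fill_row divide_inverse mult.commute)
    also have "\<dots> = (\<Sum>s=1..m. real (card S) + (1 + harm (s - 1))) / real m"
      unfolding sum_divide_distrib using step by (intro sum.cong) auto
    also have "\<dots> = (real m * real (card S) + real m * harm m) / real m"
      by (subst sum.distrib) (simp only: sum_Suc_harm_pred, simp)
    also have "\<dots> = real (card S) + harm m"
      using False by (simp add: field_simps)
    finally show ?thesis .
  qed
qed

theorem theorem1:
  fixes n :: nat
  assumes "n \<ge> 1"
  shows "measure_pmf.expectation (fill_row n {}) (\<lambda>S. real (card S)) = (\<Sum>k=1..n. 1 / real k)"
proof -
  have "accessible_seats n {} = {1..n}"
    by (auto simp: accessible_seats_def)
  then show ?thesis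
    using expectation_card_fill_row[of "{}" n n] by (simp add: harm_def inverse_eq_divide)
qed

end
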